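(* Let $(d_n)_{n\ge 0}$ be the sequence defined by $d_0=11$ and $d_n-d_{n-1}=17\cdot 2^{2n-1}$ for all $n\ge 1$. Then $d_n=\frac{1}{3}\left[17\cdot 2^{2n+1}-1\right]$ for all $n\ge 0$; for every odd number in the set $\{d_n : n\ge 0\}$, repeated application of the Collatz function $f$ eventually reaches $1$; and for each $n\ge 0$ the number of Collatz function operations needed to get $1$ from $d_n$ is $N_{d_n}=N_{17}+2n+2$.
   Context: The Collatz function $f:\mathbb{Z}_{\ge 1}\to\mathbb{Z}_{\ge 1}$ is defined by $f(n)=n/2$ if $n$ is even and $f(n)=3n+1$ if $n$ is odd. For a positive integer $k$, $N_k$ denotes the number of Collatz function operations for the number $k$ to get $1$, i.e. the least integer $m\ge 1$ such that the $m$-fold iterate satisfies $f^{m}(k)=1$ (so that $N_1=3$, via $1\to 4\to 2\to 1$), with $N_k=\infty$ if there is no such $m$. *)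

theory Defs
  imports Complex_Main "HOL-Library.Extended_Nat"
begin

text \<open>
  The Collatz function is meant on positive integers, which it maps to positive integers;
  the values it takes on other integers are irrelevant.
\<close>

definition collatz :: "int \<Rightarrow> int" where
  "collatz n = (if even n then n div 2 else 3 * n + 1)"

text \<open>
  At least one application of the function is counted, so the value at 1 is 3, not 0
  (see \<open>collatz_ops_1\<close>).
\<close>

definition collatz_ops :: "int \<Rightarrow> enat" where
  "collatz_ops k =
     (if \<exists>m\<ge>1. (collatz ^^ m) k = 1
      then enat (LEAST m. m \<ge> 1 \<and> (collatz ^^ m) k = 1)
      else \<infinity>)"

lemma collatz_pos: "n \<ge> 1 \<Longrightarrow> collatz n \<ge> 1"
  by (auto simp: collatz_def)

lemma collatz_ops_1: "collatz_ops 1 = 3"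
proof -
  have it: "(collatz ^^ 3) 1 = 1" "(collatz ^^ 1) 1 = 4" "(collatz ^^ 2) 1 = 2"
    by (simp_all add: collatz_def numeral_eq_Suc)
  have "(LEAST m. m \<ge> 1 \<and> (collatz ^^ m) 1 = 1) = (3::nat)"
  proof (rule Least_equality)
    show "(1::nat) \<le> 3 \<and> (collatz ^^ 3) 1 = 1" using it by simp
  next
    fix m :: nat assume m: "1 \<le> m \<and> (collatz ^^ m) 1 = 1"
    show "3 \<le> m"
    proof (rule ccontr)
      assume "\<not> 3 \<le> m"
      with m have "m = 1 \<or> m = 2" by auto
      with m it show False by auto
    qed
  qed
  moreover have "\<exists>m\<ge>1. (collatz ^^ m) 1 = 1"
    using it(1) by (intro exI[of _ 3]) simp
  ultimately show ?thesis
    by (simp add: collatz_ops_def numeral_eq_enat)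
qed

end

theory Submission imports Defs begin

text \<open>
  The recurrence is a geometric sum whose closed form is best read as
  \<open>3 * d n + 1 = 17 * 2 ^ (2 * n + 1)\<close>. Its right-hand side is even, so \<open>d n\<close> is odd, and
  the first Collatz step sends it to \<open>17 * 2 ^ (2 * n + 1)\<close>; the next \<open>2 * n + 1\<close> steps are
  halvings that end at 17. None of these values is 1, so the whole path of \<open>2 * n + 2\<close> steps is
  added to the count for 17. As 17 reaches 1 after 12 steps, the count for \<open>d n\<close> is
  finite, which is what reaching 1 means.

  The bookkeeping rests on \<open>collatz_ops_step\<close>: a step that does not land on 1 contributes
  exactly one operation, whether or not 1 is ever reached.
\<close>

text \<open>
  The condition on the first step matters because the count is over \<open>m \<ge> 1\<close>: from 2, one
  operation reaches 1, whereas the count at 1 starts anew and gives 3.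
\<close>
lemma collatz_ops_step:
  assumes "collatz k \<noteq> 1"
  shows "collatz_ops k = collatz_ops (collatz k) + 1"
proof -
  let ?P = "\<lambda>m. m \<ge> 1 \<and> (collatz ^^ m) k = 1"
  let ?Q = "\<lambda>m. m \<ge> 1 \<and> (collatz ^^ m) (collatz k) = 1"
  have shift: "?P (Suc m) = ?Q m" for m
    using assms by (cases m) (auto simp: funpow_Suc_right simp del: funpow.simps(2))
  have iff: "(\<exists>m. ?P m) \<longleftrightarrow> (\<exists>m. ?Q m)"
  proof
    assume "\<exists>m. ?P m"
    then obtain m where m: "?P m" by blast
    then obtain l where "m = Suc l" by (cases m) auto
    with m show "\<exists>m. ?Q m" using shift by blast
  qed (use shift in blast)
  show ?thesis
  proof (cases "\<exists>m. ?P m")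
    case True
    then obtain m where "?P m" by blast
    then have "(LEAST m. ?P m) = Suc (LEAST m. ?P (Suc m))"
      by (rule Least_Suc) simp
    also have "(\<lambda>m. ?P (Suc m)) = ?Q"
      using shift by blast
    finally show ?thesis
      using True iff by (simp add: collatz_ops_def one_enat_def)
  next
    case False
    with iff have "\<not> (\<exists>m. ?Q m)" by blast
    with False show ?thesis by (auto simp: collatz_ops_def)
  qed
qed

text \<open>
  Every step from \<open>x * 2 ^ j\<close> down to \<open>x\<close> is a halving, and all values on the way are at
  least \<open>x\<close>, so for \<open>x > 1\<close> none of them ends the count early.
\<close>
lemma collatz_ops_mult_power2:
  assumes "x > 1"
  shows "collatz_ops (x * 2 ^ j) = collatz_ops x + enat j"
proof (induction j)
  case (Suc j)
  have halve: "collatz (x * 2 ^ Suc j) = x * 2 ^ j"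
    by (simp add: collatz_def)
  have "x * 1 \<le> x * 2 ^ j"
    using assms by (intro mult_left_mono) auto
  with assms have "x * 2 ^ j \<noteq> 1" by linarith
  with halve have "collatz_ops (x * 2 ^ Suc j) = collatz_ops (x * 2 ^ j) + 1"
    using collatz_ops_step[of "x * 2 ^ Suc j"] by simp
  with Suc.IH show ?case
    by (simp add: add.assoc one_enat_def)
qed (simp flip: zero_enat_def)

lemma collatz_ops_finite_iff:
  "collatz_ops k \<noteq> \<infinity> \<longleftrightarrow> (\<exists>m\<ge>1. (collatz ^^ m) k = 1)"
  by (simp add: collatz_ops_def)

lemma collatz_ops_17_finite: "collatz_ops 17 \<noteq> \<infinity>"
proof -
  have "(collatz ^^ 12) 17 = 1"
    by (simp add: collatz_def numeral_eq_Suc)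
  then show ?thesis
    unfolding collatz_ops_finite_iff by (intro exI[of _ 12]) simp
qed

theorem theorem4:
  fixes d :: "nat \<Rightarrow> int"
  assumes d_0: "d 0 = 11"
    and d_diff: "\<And>n. n \<ge> 1 \<Longrightarrow> d n - d (n - 1) = 17 * 2 ^ (2 * n - 1)"
  shows "(\<forall>n. real_of_int (d n) = 1 / 3 * (17 * 2 ^ (2 * n + 1) - 1)) \<and>
         (\<forall>k \<in> {d n | n. True}. odd k \<longrightarrow> (\<exists>m. (collatz ^^ m) k = 1)) \<and>
         (\<forall>n. collatz_ops (d n) = collatz_ops 17 + enat (2 * n + 2))"
proof -
  have closed: "3 * d n + 1 = 17 * 2 ^ (2 * n + 1)" for n
  proof (induction n)
    case (Suc n)
    then show ?case using d_diff[of "Suc n"] by simp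
  qed (simp add: d_0)
  have formula: "real_of_int (d n) = 1 / 3 * (17 * 2 ^ (2 * n + 1) - 1)" for n
  proof -
    have "real_of_int (3 * d n + 1) = real_of_int (17 * 2 ^ (2 * n + 1))"
      by (simp only: closed)
    then show ?thesis by simp
  qed
  have ops: "collatz_ops (d n) = collatz_ops 17 + enat (2 * n + 2)" for n
  proof -
    have "even (3 * d n + 1)" unfolding closed by simp
    then have "odd (d n)" by simp
    then have step: "collatz (d n) = 17 * 2 ^ (2 * n + 1)"
      using closed[of n] by (simp add: collatz_def)
    have "even (collatz (d n))" unfolding step by simp
    then have "collatz (d n) \<noteq> 1" by auto
    then have "collatz_ops (d n) = collatz_ops (17 * 2 ^ (2 * n + 1)) + 1"
      using collatz_ops_step[of "d n"] unfolding step by simp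
    also have "\<dots> = collatz_ops 17 + enat (2 * n + 1) + 1"
      by (subst collatz_ops_mult_power2) simp_all
    finally show ?thesis by (simp add: add.assoc one_enat_def)
  qed
  have "\<exists>m. (collatz ^^ m) (d n) = 1" for n
  proof -
    have "collatz_ops (d n) \<noteq> \<infinity>"
      using ops[of n] collatz_ops_17_finite by auto
    then show ?thesis unfolding collatz_ops_finite_iff by blast
  qed
  with formula ops show ?thesis by blast
qed

end
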